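(* Let $\mathbb{F}$ be a field, $\alpha,\beta,\gamma \in \mathbb{F}$, and let $f = \alpha(x_1x_2 + x_3x_4) + \beta(x_1x_3 + x_2x_4) + \gamma(x_1x_4 + x_2x_3) \in \mathbb{F}[x_1,x_2,x_3,x_4]$. The following are equivalent: (1) $f$ is not expressible as the sum of two read-once polynomials over $\mathbb{F}$; (2) $\alpha,\beta,\gamma$ satisfy all three of the following conditions: C1: $\alpha\beta\gamma \neq 0$; C2: $(\alpha^2-\beta^2)(\beta^2-\gamma^2)(\gamma^2-\alpha^2) \neq 0$; C3: none of the equations $X^2 - d_i = 0$, $i \in [3]$, has a root in $\mathbb{F}$, where $d_1 = (\alpha^2-\beta^2-\gamma^2)^2 - (2\beta\gamma)^2$, $d_2 = (-\alpha^2+\beta^2-\gamma^2)^2 - (2\alpha\gamma)^2$, $d_3 = (-\alpha^2-\beta^2+\gamma^2)^2 - (2\alpha\beta)^2$.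
   Context: A read-once formula (ROF) over a field $\mathbb{F}$ is a binary tree whose leaves are labeled by variables and whose internal nodes are labeled by $+$ or $\times$; every node additionally carries a pair $(a,b) \in \mathbb{F}^2$, and each variable labels at most one leaf. A leaf labeled $x_i$ with pair $(a,b)$ computes $a x_i + b$; an internal node labeled $\star \in \{+,\times\}$ with pair $(a,b)$ whose children compute $f_1,f_2$ computes $a(f_1 \star f_2) + b$. A read-once polynomial (ROP) is a polynomial computed by some ROF (constants are also regarded as ROPs).
   Formalization: The field is assumed to have characteristic different from 2; in characteristic 2 each d_i is (α+β+γ)^4, so C3 always fails, yet over the field with 8 elements (t^3=t+1) f with (α,β,γ)=(1,t,t^2) is not a sum of two read-once polynomials. *)

theory Defs
  imports "HOL-Library.Poly_Mapping"
begin

text \<open>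
  Multivariate polynomials as finitely supported maps from monomials (themselves finitely supported
  exponent vectors) to coefficients.  The ring has countably many indeterminates; a read-once
  formula may use any of them.
\<close>

type_synonym 'a mpoly = "(nat \<Rightarrow>\<^sub>0 nat) \<Rightarrow>\<^sub>0 'a"

definition Const :: "'a::zero \<Rightarrow> 'a mpoly" where
  "Const c = Poly_Mapping.single 0 c"

definition Var :: "nat \<Rightarrow> 'a::zero_neq_one mpoly" where
  "Var i = Poly_Mapping.single (Poly_Mapping.single i 1) 1"

datatype gate = Plus | Times

datatype 'a formula =
    Leaf nat 'a 'a
  | Node gate 'a 'a "'a formula" "'a formula"

fun gate_op :: "gate \<Rightarrow> 'a::comm_ring_1 mpoly \<Rightarrow> 'a mpoly \<Rightarrow> 'a mpoly" where
  "gate_op Plus p q = p + q"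
| "gate_op Times p q = p * q"

fun computes :: "'a::comm_ring_1 formula \<Rightarrow> 'a mpoly" where
  "computes (Leaf i a b) = Const a * Var i + Const b"
| "computes (Node g a b l r) = Const a * gate_op g (computes l) (computes r) + Const b"

fun leaf_labels :: "'a formula \<Rightarrow> nat list" where
  "leaf_labels (Leaf i a b) = [i]"
| "leaf_labels (Node g a b l r) = leaf_labels l @ leaf_labels r"

definition read_once_formula :: "'a formula \<Rightarrow> bool" where
  "read_once_formula \<phi> \<longleftrightarrow> distinct (leaf_labels \<phi>)"

definition read_once_polynomial :: "'a::comm_ring_1 mpoly \<Rightarrow> bool" where
  "read_once_polynomial p \<longleftrightarrow>
    (\<exists>\<phi>. read_once_formula \<phi> \<and> computes \<phi> = p) \<or> (\<exists>c. p = Const c)"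

text \<open>
  Consider \<open>f = \<alpha>(x\<^sub>1x\<^sub>2 + x\<^sub>3x\<^sub>4) + \<beta>(x\<^sub>1x\<^sub>3 + x\<^sub>2x\<^sub>4) + \<gamma>(x\<^sub>1x\<^sub>4 + x\<^sub>2x\<^sub>3)\<close>.  Deciding by a square test on
  \<open>(\<alpha>\<^sup>2 - \<beta>\<^sup>2 - \<gamma>\<^sup>2)\<^sup>2 - (2\<beta>\<gamma>)\<^sup>2\<close> whether \<open>f\<close> is a sum of two read-once polynomials requires
  characteristic different from 2.  In characteristic 2 this expression equals
  \<open>(\<alpha> + \<beta> + \<gamma>)\<^sup>4\<close>, always a square; yet over the field with 8 elements, \<open>f\<close> is not such a sum
  for \<open>(\<alpha>, \<beta>, \<gamma>) = (1, t, t\<^sup>2)\<close> with \<open>t\<^sup>3 = t + 1\<close>.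
\<close>

end

theory Submission
  imports Defs
begin

text \<open>
  Only the coefficients of multilinear monomials in \<open>x\<^sub>1, \<dots>, x\<^sub>4\<close> matter, and setting a variable
  to a constant keeps a formula read-once.  A read-once polynomial in three variables cannot have all
  three quadratic coefficients nonzero and no cubic one.  Consequently a read-once polynomial \<open>p\<close> in
  four variables either becomes linear when some variable is set to a suitable constant, or it is
  \<open>g(A) h(B) + c\<close> or \<open>g(A) + h(B)\<close> with \<open>|A| = |B| = 2\<close>.  Suppose that C1 and C2 hold and
  \<open>f = p + q\<close>.  In the first case \<open>q\<close>, restricted in the same way, has three quadratic terms but no
  cubic one.  If \<open>p = g(A) + h(B)\<close>, then \<open>q\<close> contains the other four quadratic terms; they form a
  4-cycle, so \<open>q\<close> is no such sum, and as \<open>q\<close> has no cubic terms, being a product would make two of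
  \<open>\<alpha>\<^sup>2, \<beta>\<^sup>2, \<gamma>\<^sup>2\<close> equal.  If both are products for the same partition, the coefficient
  matrix of \<open>f\<close> would have rank at most 2, which again makes two of the squares equal.  For different
  partitions the absence of cubic and quartic terms in \<open>f\<close> forces all factors to be linear, and
  comparing coefficients exhibits \<open>d\<^sub>1 = d\<^sub>2 = d\<^sub>3\<close> as a square.  Conversely, a square root of
  \<open>d\<^sub>1\<close> yields a decomposition of this last kind.
\<close>

section \<open>Multilinear coefficients of read-once formulas\<close>

text \<open>For infinite \<open>S\<close> the sum defaults to 0 and \<open>monomial_of S\<close> is
  the constant monomial; this is the source of the finiteness premises below.\<close>

definition monomial_of :: "nat set \<Rightarrow> nat \<Rightarrow>\<^sub>0 nat" where
  "monomial_of S = (\<Sum>i\<in>S. Poly_Mapping.single i 1)"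

definition coef :: "'a::zero mpoly \<Rightarrow> nat set \<Rightarrow> 'a" where
  "coef p S = Poly_Mapping.lookup p (monomial_of S)"

definition indets :: "'a::zero mpoly \<Rightarrow> nat set" where
  "indets p = (\<Union>m\<in>Poly_Mapping.keys p. Poly_Mapping.keys m)"

lemma lookup_monomial_of:
  "finite S \<Longrightarrow> Poly_Mapping.lookup (monomial_of S) i = (if i \<in> S then 1 else 0)"
  by (simp add: monomial_of_def lookup_sum lookup_single when_def)

lemma keys_monomial_of: "finite S \<Longrightarrow> Poly_Mapping.keys (monomial_of S) = S"
  by (auto simp: in_keys_iff lookup_monomial_of split: if_splits)

lemma monomial_of_inject: "finite S \<Longrightarrow> finite T \<Longrightarrow> monomial_of S = monomial_of T \<longleftrightarrow> S = T"
  by (metis keys_monomial_of)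

lemma coef_add: "coef (p + q) S = coef p S + coef q S"
  by (simp add: coef_def lookup_add)

lemma coef_Const: "finite S \<Longrightarrow> coef (Const c) S = (if S = {} then c else 0)"
  using monomial_of_inject[of "{}" S]
  by (auto simp: coef_def Const_def lookup_single when_def monomial_of_def)

lemma coef_Var: "finite S \<Longrightarrow> coef (Var i) S = (if S = {i} then 1 else 0)"
  using monomial_of_inject[of "{i}" S]
  by (auto simp: coef_def Var_def lookup_single when_def monomial_of_def)

lemma coef_eq_0: "finite S \<Longrightarrow> \<not> S \<subseteq> indets p \<Longrightarrow> coef p S = 0"
  using keys_monomial_of[of S] unfolding coef_def indets_def
  by (metis UN_upper in_keys_iff)

text \<open>A monomial factors in only one way into a part with variables in \<open>A\<close> and a
  part with variables outside \<open>A\<close>, so at most one term of the convolution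
  survives.\<close>

lemma coef_mult:
  assumes "finite S" and p: "indets p \<subseteq> A" and q: "indets q \<inter> A = {}"
  shows "coef (p * q) S = coef p (S \<inter> A) * coef q (S - A)"
proof -
  have split: "monomial_of S = monomial_of (S \<inter> A) + monomial_of (S - A)"
    using assms(1) by (intro poly_mapping_eqI) (simp add: lookup_add lookup_monomial_of)
  have "Poly_Mapping.lookup p l * (\<Sum>r. Poly_Mapping.lookup q r when monomial_of S = l + r) =
      (if l = monomial_of (S \<inter> A) then coef p (S \<inter> A) * coef q (S - A) else 0)" for l
  proof (cases "l = monomial_of (S \<inter> A)")
    case True
    then have "(\<Sum>r. Poly_Mapping.lookup q r when monomial_of S = l + r) = coef q (S - A)"
      by (simp add: split coef_def)
    then show ?thesis
      using True by (simp add: coef_def)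
  next
    case False
    have "(Poly_Mapping.lookup q r when monomial_of S = l + r) = 0"
      if "Poly_Mapping.lookup p l \<noteq> 0" for r
    proof (rule ccontr)
      assume "(Poly_Mapping.lookup q r when monomial_of S = l + r) \<noteq> 0"
      then have r: "Poly_Mapping.lookup q r \<noteq> 0" and S: "monomial_of S = l + r"
        by (auto simp: when_def split: if_splits)
      have "Poly_Mapping.keys l \<subseteq> A" "Poly_Mapping.keys r \<inter> A = {}"
        using p q that r unfolding indets_def in_keys_iff[symmetric] by blast+
      \<comment> \<open>The exponents of \<open>l\<close> and \<open>r\<close> never overlap, so
        those of \<open>l\<close> can be read off from \<open>S\<close>.\<close>
      then have z: "i \<notin> A \<Longrightarrow> Poly_Mapping.lookup l i = 0"
          "i \<in> A \<Longrightarrow> Poly_Mapping.lookup r i = 0" for i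
        by (auto simp: in_keys_iff)
      have "l = monomial_of (S \<inter> A)"
      proof (rule poly_mapping_eqI)
        fix i
        have "Poly_Mapping.lookup (monomial_of S) i
            = Poly_Mapping.lookup l i + Poly_Mapping.lookup r i"
          by (simp add: S lookup_add)
        then show "Poly_Mapping.lookup l i = Poly_Mapping.lookup (monomial_of (S \<inter> A)) i"
          using z[of i] assms(1) by (cases "i \<in> A") (simp_all add: lookup_monomial_of)
      qed
      with False show False ..
    qed
    then show ?thesis
      using False by (cases "Poly_Mapping.lookup p l = 0") simp_all
  qed
  then show ?thesis
    by (simp add: coef_def[of "p * q"] lookup_mult)
qed

section \<open>Variables occurring in a polynomial\<close>

lemma indets_Const: "indets (Const c) = {}"
  by (simp add: indets_def Const_def)

lemma indets_Var: "indets (Var i) = {i}"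
  by (simp add: indets_def Var_def)

lemma indets_add: "indets (p + q) \<subseteq> indets p \<union> indets q"
  using Poly_Mapping.keys_add[of p q] by (auto simp: indets_def)

lemma indets_mult: "indets (p * q) \<subseteq> indets p \<union> indets (q :: 'a::comm_ring_1 mpoly)"
proof
  fix i assume "i \<in> indets (p * q)"
  then obtain m where "m \<in> Poly_Mapping.keys (p * q)" "i \<in> Poly_Mapping.keys m"
    by (auto simp: indets_def)
  with keys_mult[of p q] obtain a b where "a \<in> Poly_Mapping.keys p" "b \<in> Poly_Mapping.keys q"
      "i \<in> Poly_Mapping.keys (a + b)"
    by blast
  with Poly_Mapping.keys_add[of a b] show "i \<in> indets p \<union> indets q"
    by (auto simp: indets_def)
qed

lemma coef_Const_mult: "finite S \<Longrightarrow> coef (Const a * p) S = a * coef p S"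
  by (subst coef_mult[of _ _ "{}"]) (simp_all add: indets_Const coef_Const)

lemma indets_computes: "indets (computes \<phi>) \<subseteq> set (leaf_labels \<phi>)"
proof (induction \<phi>)
  case (Leaf i a b)
  have "indets (Const a * Var i + Const b) \<subseteq> {i}"
    using indets_add[of "Const a * Var i" "Const b"] indets_mult[of "Const a" "Var i"]
    by (auto simp: indets_Const indets_Var)
  then show ?case by simp
next
  case (Node g a b l r)
  have "indets (gate_op g (computes l) (computes r)) \<subseteq> indets (computes l) \<union> indets (computes r)"
    by (cases g) (simp_all add: indets_add indets_mult)
  then have "indets (gate_op g (computes l) (computes r)) \<subseteq> set (leaf_labels (Node g a b l r))"
    using Node by auto
  then show ?case
    using indets_add[of "Const a * gate_op g (computes l) (computes r)" "Const b"]
      indets_mult[of "Const a" "gate_op g (computes l) (computes r)"]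
    by (simp add: indets_Const)
qed

section \<open>Coefficients of read-once formulas under gates and substitution\<close>

abbreviation fcoef :: "'a::comm_ring_1 formula \<Rightarrow> nat set \<Rightarrow> 'a" where
  "fcoef \<phi> \<equiv> coef (computes \<phi>)"

lemma fcoef_eq_0: "finite S \<Longrightarrow> \<not> S \<subseteq> set (leaf_labels \<phi>) \<Longrightarrow> fcoef \<phi> S = 0"
  using coef_eq_0 indets_computes by blast

lemma fcoef_Leaf:
  "finite S \<Longrightarrow> fcoef (Leaf i a b) S = (if S = {} then b else if S = {i} then a else 0)"
  by (simp add: coef_add coef_Const_mult coef_Const coef_Var)

lemma fcoef_Plus:
  "finite S \<Longrightarrow>
    fcoef (Node Plus a b l r) S = a * (fcoef l S + fcoef r S) + (if S = {} then b else 0)"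
  by (simp add: coef_add coef_Const_mult coef_Const)

lemma fcoef_Times:
  assumes "finite S" "read_once_formula (Node Times a b l r)"
  shows "fcoef (Node Times a b l r) S =
    a * (fcoef l (S \<inter> set (leaf_labels l)) * fcoef r (S - set (leaf_labels l)))
      + (if S = {} then b else 0)"
proof -
  have "indets (computes r) \<inter> set (leaf_labels l) = {}"
    using assms(2) indets_computes[of r] by (auto simp: read_once_formula_def)
  then show ?thesis
    using assms(1) indets_computes[of l] by (simp add: coef_add coef_Const_mult coef_Const coef_mult)
qed

lemma read_once_formula_Node:
  "read_once_formula (Node g a b l r) \<longleftrightarrow> read_once_formula l \<and> read_once_formula r
    \<and> set (leaf_labels l) \<inter> set (leaf_labels r) = {}"
  by (auto simp: read_once_formula_def)

text \<open>Models the substitution of \<open>t\<close> for \<open>x_i\<close>. The leaf keeps its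
  label and gets slope 0, so the tree and its labels do not change.\<close>

fun restrict :: "nat \<Rightarrow> 'a::comm_ring_1 \<Rightarrow> 'a formula \<Rightarrow> 'a formula" where
  "restrict i t (Leaf j a b) = (if j = i then Leaf j 0 (a * t + b) else Leaf j a b)"
| "restrict i t (Node g a b l r) = Node g a b (restrict i t l) (restrict i t r)"

lemma leaf_labels_restrict [simp]: "leaf_labels (restrict i t \<phi>) = leaf_labels \<phi>"
  by (induction \<phi>) simp_all

lemma read_once_restrict [simp]: "read_once_formula (restrict i t \<phi>) = read_once_formula \<phi>"
  by (simp add: read_once_formula_def)

text \<open>A read-once polynomial is affine in \<open>x_i\<close>: substituting \<open>t\<close>
  adds \<open>t\<close> times the cofactor of \<open>x_i\<close> to the part free of
  \<open>x_i\<close>. At a product gate at most one factor contains \<open>x_i\<close>.\<close>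

lemma fcoef_restrict:
  assumes "read_once_formula \<phi>" "finite S" "i \<notin> S"
  shows "fcoef (restrict i t \<phi>) S = fcoef \<phi> S + t * fcoef \<phi> (insert i S)"
  using assms
proof (induction \<phi> arbitrary: S)
  case (Leaf j a b)
  then show ?case
    by (auto simp: fcoef_Leaf simp del: computes.simps)
next
  case (Node g a b l r)
  let ?L = "set (leaf_labels l)"
  note ro = Node.prems(1)[unfolded read_once_formula_Node]
  show ?case
  proof (cases g)
    case Plus
    with Node ro show ?thesis
      by (simp add: fcoef_Plus algebra_simps del: computes.simps)
  next
    case Times
    note ro' = Node.prems(1)[unfolded Times]
    have ro'': "read_once_formula (Node Times a b (restrict i t l) (restrict i t r))"
      using ro' by (simp add: read_once_formula_def)
    consider "i \<in> ?L" | "i \<notin> ?L" by blast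
    then show ?thesis
    proof cases
      case 1
      then have "i \<notin> set (leaf_labels r)" using ro by auto
      \<comment> \<open>With this, the induction hypothesis for \<open>r\<close> says that the
        substitution leaves the coefficient of that factor unchanged.\<close>
      then have z: "fcoef r (insert i (S - ?L)) = 0"
        using Node.prems by (intro fcoef_eq_0) auto
      show ?thesis
        using Node ro 1 z
        by (simp add: Times fcoef_Times[OF _ ro'] fcoef_Times[OF _ ro''] Int_insert_left
            insert_Diff_if algebra_simps del: computes.simps)
    next
      case 2
      then have z: "fcoef l (insert i (S \<inter> ?L)) = 0"
        using Node.prems by (intro fcoef_eq_0) auto
      show ?thesis
        using Node ro 2 z
        by (simp add: Times fcoef_Times[OF _ ro'] fcoef_Times[OF _ ro''] Int_insert_left
            insert_Diff_if algebra_simps del: computes.simps)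
    qed
  qed
qed

text \<open>If all three quadratic terms occur, every gate joining two of the variables is a product, and
  this creates the cubic term.\<close>

lemma fcoef_triangle:
  fixes \<phi> :: "'a::field formula"
  assumes "read_once_formula \<phi>" "i \<noteq> j" "i \<noteq> k" "j \<noteq> k"
    and "fcoef \<phi> {i, j} \<noteq> 0" "fcoef \<phi> {i, k} \<noteq> 0" "fcoef \<phi> {j, k} \<noteq> 0"
  shows "fcoef \<phi> {i, j, k} \<noteq> 0"
  using assms
proof (induction \<phi>)
  case (Leaf m a b)
  then show ?case
    by (auto simp: fcoef_Leaf doubleton_eq_iff simp del: computes.simps split: if_splits)
next
  case (Node g a b l r)
  let ?L = "set (leaf_labels l)" and ?R = "set (leaf_labels r)"
  note ro = Node.prems(1)[unfolded read_once_formula_Node]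
  have l0: "fcoef l S = 0" if "finite S" "\<not> S \<subseteq> ?L" for S using that by (rule fcoef_eq_0)
  have r0: "fcoef r S = 0" if "finite S" "\<not> S \<subseteq> ?R" for S using that by (rule fcoef_eq_0)
  have dis: "x \<in> ?L \<Longrightarrow> x \<notin> ?R" for x using ro by auto
  show ?case
  proof (cases g)
    case Plus
    show ?thesis
      using Node.IH ro Node.prems(2-)
      by (cases "i \<in> ?L"; cases "j \<in> ?L"; cases "k \<in> ?L")
        (simp_all add: Plus fcoef_Plus l0 r0 dis del: computes.simps)
  next
    case Times
    note ro' = Node.prems(1)[unfolded Times]
    \<comment> \<open>If the gate separates one variable from the other two, its linear coefficient
      and their quadratic coefficient are nonzero, and the cubic coefficient is \<open>a\<close>
      times their product. If all three lie on one side, the induction hypothesis applies.\<close>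
    show ?thesis
      using Node.IH ro Node.prems(2-)
      by (cases "i \<in> ?L"; cases "j \<in> ?L"; cases "k \<in> ?L")
        (simp_all add: Times fcoef_Times[OF _ ro'] Int_insert_left insert_Diff_if l0 r0 dis
          del: computes.simps)
  qed
qed

section \<open>Read-once formulas on four variables\<close>

text \<open>The expression is the coefficient at \<open>S\<close> after setting \<open>x_i\<close>
  to \<open>t\<close>; thus some such substitution leaves no term of degree 2 or more.\<close>

definition line_linear :: "nat set \<Rightarrow> (nat set \<Rightarrow> 'a::field) \<Rightarrow> bool" where
  "line_linear W c \<longleftrightarrow>
    (\<exists>i\<in>W. \<exists>t. \<forall>S\<subseteq>W - {i}. 2 \<le> card S \<longrightarrow> c S + t * c (insert i S) = 0)"

text \<open>The empty set is exempt because a constant may be added to the product.\<close>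

definition product_split :: "nat set \<Rightarrow> (nat set \<Rightarrow> 'a::field) \<Rightarrow> bool" where
  "product_split W c \<longleftrightarrow>
    (\<exists>A\<subseteq>W. card A = 2 \<and> (\<exists>g h. \<forall>S\<subseteq>W. S \<noteq> {} \<longrightarrow> c S = g (S \<inter> A) * h (S - A)))"

text \<open>Constant and linear terms are left free, since they can be distributed over the two
  summands anyway.\<close>

definition sum_split :: "nat set \<Rightarrow> (nat set \<Rightarrow> 'a::field) \<Rightarrow> bool" where
  "sum_split W c \<longleftrightarrow>
    (\<exists>A\<subseteq>W. card A = 2 \<and> (\<forall>S\<subseteq>W. 2 \<le> card S \<longrightarrow> S \<noteq> A \<longrightarrow> S \<noteq> W - A \<longrightarrow> c S = 0))"

lemma product_splitI:
  assumes "A \<subseteq> W" "card A = 2"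
    and "\<And>S. S \<subseteq> W \<Longrightarrow> S \<noteq> {} \<Longrightarrow> c S = g (S \<inter> A) * h (S - A)"
  shows "product_split W c"
  unfolding product_split_def 
  by (intro exI[of _ A] exI[of _ g] exI[of _ h] conjI allI impI assms)

text \<open>The variable set to \<open>t\<close> is \<open>z\<close>, not \<open>i\<close>: the
  terms containing \<open>x_i\<close> vanish by assumption, and the only other set to treat is
  \<open>{x, y}\<close>.\<close>

lemma line_linear_pair:
  assumes "distinct [i, x, y, z]" "c {x, y} + t * c {x, y, z} = 0"
    and zero: "\<And>S. S \<subseteq> {i, x, y, z} \<Longrightarrow> i \<in> S \<Longrightarrow> 2 \<le> card S \<Longrightarrow> c S = 0"
  shows "line_linear {i, x, y, z} c"
proof -
  have "c S + t * c (insert z S) = 0" if S: "S \<subseteq> {i, x, y, z} - {z}" "2 \<le> card S" for S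
  proof (cases "i \<in> S")
    case True
    have "finite S" using S(1) finite_subset by blast
    then have "2 \<le> card (insert z S)" using S(2) by (simp add: card_insert_if)
    moreover have "S \<subseteq> {i, x, y, z}" "insert z S \<subseteq> {i, x, y, z}" using S(1) by auto
    ultimately show ?thesis using S(2) True zero[of S] zero[of "insert z S"] by simp
  next
    case False
    with S(1) have "S \<subseteq> {x, y}" by auto
    moreover have "card {x, y} \<le> card S" using S(2) by (simp add: card_insert_if)
    ultimately have "S = {x, y}" by (intro card_seteq) auto
    moreover have "insert z {x, y} = {x, y, z}" by auto
    ultimately show ?thesis using assms(2) by simp
  qed
  then show ?thesis unfolding line_linear_def by blast
qed

text \<open>Killing one further variable makes a read-once polynomial in three variables linear: either
  its cubic coefficient is nonzero and can be balanced against a quadratic one, or by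
  the absence of triangles one quadratic coefficient vanishes already.\<close>

lemma line_linear_free:
  fixes \<phi> :: "'a::field formula"
  assumes ro: "read_once_formula \<phi>" and W: "card W = 4" "i \<in> W"
    and zero: "\<And>S. S \<subseteq> W \<Longrightarrow> i \<in> S \<Longrightarrow> 2 \<le> card S \<Longrightarrow> fcoef \<phi> S = 0"
  shows "line_linear W (fcoef \<phi>)"
proof -
  have "card (W - {i}) = 3" using W by simp
  then obtain j k l where jkl: "W - {i} = {j, k, l}" "j \<noteq> k" "k \<noteq> l" "j \<noteq> l"
    by (metis card_3_iff)
  have WW: "W = {i, j, k, l}" and "i \<notin> {j, k, l}" using jkl(1) W(2) by auto
  then have dist: "distinct [i, j, k, l]" using jkl by auto
  consider "fcoef \<phi> {j, k, l} \<noteq> 0" | "fcoef \<phi> {j, k, l} = 0" "fcoef \<phi> {j, k} = 0"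
    | "fcoef \<phi> {j, k, l} = 0" "fcoef \<phi> {j, l} = 0"
    | "fcoef \<phi> {j, k, l} = 0" "fcoef \<phi> {k, l} = 0"
    using fcoef_triangle[OF ro jkl(2,4,3)] by blast
  then obtain x y z t where xyz: "{x, y, z} = {j, k, l}" "distinct [i, x, y, z]"
      "fcoef \<phi> {x, y} + t * fcoef \<phi> {x, y, z} = 0"
  proof cases
    case 1
    then have "fcoef \<phi> {j, k} + (- fcoef \<phi> {j, k} / fcoef \<phi> {j, k, l}) * fcoef \<phi> {j, k, l} = 0"
      by simp
    with dist show ?thesis using that[of j k l] by blast
  next
    case 2
    with dist show ?thesis using that[of j k l 0] by simp
  next
    case 3
    with dist show ?thesis using that[of j l k 0] by (simp add: insert_commute)
  next
    case 4
    with dist show ?thesis using that[of k l j 0] by (simp add: insert_commute)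
  qed
  have "W = {i, x, y, z}" using WW xyz(1) by simp
  with line_linear_pair[OF xyz(2,3)] zero show ?thesis by simp
qed

text \<open>Setting \<open>x_i\<close> to the root \<open>- p {} / p {i}\<close> of its affine
  factor kills the whole product. Without a root, \<open>p {i}\<close> is 0 or can be taken so, and
  \<open>x_i\<close> does not occur.\<close>

lemma line_linear_product:
  fixes \<phi> :: "'a::field formula"
  assumes ro: "read_once_formula \<phi>" and W: "card W = 4" "i \<in> W"
    and prod: "\<And>S. S \<subseteq> W \<Longrightarrow> S \<noteq> {} \<Longrightarrow> fcoef \<phi> S = p (S \<inter> {i}) * q (S - {i})"
  shows "line_linear W (fcoef \<phi>)"
proof (cases "p {i} = 0")
  case True
  have "fcoef \<phi> S = 0" if "S \<subseteq> W" "i \<in> S" for S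
    using prod[of S] that True by (cases "S = {}") (auto simp: Int_insert_right)
  then show ?thesis using line_linear_free[OF ro W] by blast
next
  case False
  have "fcoef \<phi> S + (- p {} / p {i}) * fcoef \<phi> (insert i S) = 0"
    if S: "S \<subseteq> W - {i}" "2 \<le> card S" for S
  proof -
    have "S \<inter> {i} = {}" "S - {i} = S" "insert i S - {i} = S" "insert i S \<inter> {i} = {i}" "S \<noteq> {}"
      using S by auto
    moreover have "S \<subseteq> W" "insert i S \<subseteq> W" using S W(2) by auto
    ultimately show ?thesis
      using prod[of S] prod[of "insert i S"] False by simp
  qed
  with W(2) show ?thesis unfolding line_linear_def by blast
qed

text \<open>Serves gates with only one child meeting \<open>W\<close>: such a gate rescales the
  nonconstant coefficients, and all three shapes survive this, even for
  \<open>k = 0\<close>.\<close>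

lemma read_once_split_scale:
  assumes "line_linear W c \<or> product_split W c \<or> sum_split W c"
    and eq: "\<And>S. S \<subseteq> W \<Longrightarrow> S \<noteq> {} \<Longrightarrow> d S = k * c S"
  shows "line_linear W d \<or> product_split W d \<or> sum_split W d"
  using assms(1)
proof (elim disjE)
  assume "line_linear W c"
  then obtain i t where i: "i \<in> W"
    and t: "\<And>S. S \<subseteq> W - {i} \<Longrightarrow> 2 \<le> card S \<Longrightarrow> c S + t * c (insert i S) = 0"
    unfolding line_linear_def by blast
  have "d S + t * d (insert i S) = 0" if "S \<subseteq> W - {i}" "2 \<le> card S" for S
  proof -
    have "S \<subseteq> W" "insert i S \<subseteq> W" "S \<noteq> {}" using that i by auto
    then have "d S + t * d (insert i S) = k * (c S + t * c (insert i S))"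
      using eq[of S] eq[of "insert i S"] by (simp add: algebra_simps)
    with t[OF that] show ?thesis by simp
  qed
  with i show ?thesis unfolding line_linear_def by blast
next
  assume "product_split W c"
  then obtain A g h where A: "A \<subseteq> W" "card A = 2"
    and gh: "\<And>S. S \<subseteq> W \<Longrightarrow> S \<noteq> {} \<Longrightarrow> c S = g (S \<inter> A) * h (S - A)"
    unfolding product_split_def by blast
  have "product_split W d"
    by (rule product_splitI[OF A, of _ "\<lambda>S. k * g S" h]) (simp add: eq gh mult.assoc)
  then show ?thesis by blast
next
  assume "sum_split W c"
  then obtain A where A: "A \<subseteq> W" "card A = 2"
    and z: "\<And>S. S \<subseteq> W \<Longrightarrow> 2 \<le> card S \<Longrightarrow> S \<noteq> A \<Longrightarrow> S \<noteq> W - A \<Longrightarrow> c S = 0"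
    unfolding sum_split_def by blast
  have "d S = 0" if "S \<subseteq> W" "2 \<le> card S" "S \<noteq> A" "S \<noteq> W - A" for S
  proof -
    have "S \<noteq> {}" using that(2) by auto
    with eq[OF that(1)] z[OF that] show ?thesis by simp
  qed
  with A show ?thesis unfolding sum_split_def by blast
qed

text \<open>Induction on the tree, according to how the root gate divides \<open>W\<close>. With 0
  against 4 the shape is inherited; with 1 against 3 one variable is isolated, giving
  \<open>line_linear\<close>; 2 against 2 gives a product or a sum.\<close>

lemma read_once_split:
  fixes \<phi> :: "'a::field formula"
  assumes "read_once_formula \<phi>" "card W = 4"
  shows "line_linear W (fcoef \<phi>) \<or> product_split W (fcoef \<phi>) \<or> sum_split W (fcoef \<phi>)"
  using assms(1)
proof (induction \<phi>)
  case (Leaf i a b)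
  have "fcoef (Leaf i a b) S = 0" if "S \<subseteq> W" "2 \<le> card S" for S
    using that assms(2) fcoef_eq_0[of S "Leaf i a b"] card_mono[of "{i}" S]
    by (cases "finite S") (auto simp del: computes.simps)
  moreover have "W \<noteq> {}" using assms(2) by auto
  ultimately show ?case
    using line_linear_free[OF Leaf assms(2)] by blast
next
  case (Node g a b l r)
  let ?L = "set (leaf_labels l)" and ?R = "set (leaf_labels r)" and ?c = "fcoef (Node g a b l r)"
  note ro = Node.prems(1)[unfolded read_once_formula_Node]
  have finW: "finite W" using assms(2) card.infinite by fastforce
  then have fin: "S \<subseteq> W \<Longrightarrow> finite S" for S by (rule finite_subset[rotated])
  show ?case
  proof (cases "W \<subseteq> ?L \<union> ?R")
    case False
    then obtain i where i: "i \<in> W" "i \<notin> ?L \<union> ?R" by blast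
    have "?c S = 0" if "S \<subseteq> W" "i \<in> S" for S
      using that i fin by (intro fcoef_eq_0) auto
    then show ?thesis using line_linear_free[OF Node.prems assms(2) i(1)] by blast
  next
    case True
    with ro have compl: "W \<inter> ?R = W - ?L" "W \<inter> ?L = W - ?R" by auto
    have plus: "?c S = a * (fcoef l S + fcoef r S)" if "g = Plus" "S \<subseteq> W" "S \<noteq> {}" for S
      using that fin by (simp add: fcoef_Plus del: computes.simps)
    have times: "?c S = a * fcoef l (S \<inter> ?L) * fcoef r (S - ?L)"
      if "g = Times" "S \<subseteq> W" "S \<noteq> {}" for S
      using fcoef_Times[OF _ Node.prems[unfolded that(1)], of S] that fin
      by (simp add: mult.assoc del: computes.simps)
    have l0: "fcoef l S = 0" if "S \<subseteq> W" "\<not> S \<subseteq> ?L" for S using that fin by (intro fcoef_eq_0)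
    have r0: "fcoef r S = 0" if "S \<subseteq> W" "\<not> S \<subseteq> ?R" for S using that fin by (intro fcoef_eq_0)
    have card: "card (W \<inter> ?L) + card (W - ?L) = 4"
      using card_Un_disjoint[of "W \<inter> ?L" "W - ?L"] finW assms(2)
      by (metis Diff_disjoint Int_Diff_Un Int_Diff_disjoint finite_Diff finite_Int)
    then consider "card (W \<inter> ?L) = 0" | "card (W \<inter> ?L) = 1" | "card (W \<inter> ?L) = 2"
      | "card (W - ?L) = 1" | "card (W - ?L) = 0"
      by linarith
    then show ?thesis
    proof cases
      case 1
      then have WL: "W \<inter> ?L = {}" using finW by simp
      have IH: "line_linear W (fcoef r) \<or> product_split W (fcoef r) \<or> sum_split W (fcoef r)"
        using Node.IH(2) ro by blast
      \<comment> \<open>On nonempty subsets of \<open>W\<close> the left child contributes nothing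
        to a sum and only its constant coefficient to a product.\<close>
      have "?c S = (a * (if g = Times then fcoef l {} else 1)) * fcoef r S"
        if S: "S \<subseteq> W" "S \<noteq> {}" for S
      proof -
        have *: "S \<inter> ?L = {}" "S - ?L = S" "\<not> S \<subseteq> ?L" using WL S by auto
        show ?thesis
          using l0[OF S(1) *(3)] plus[OF _ S] times[OF _ S, unfolded *]
          by (cases g) (simp_all del: computes.simps)
      qed
      then show ?thesis by (rule read_once_split_scale[OF IH])
    next
      case 5
      then have WL: "W - ?L = {}" using finW by simp
      have IH: "line_linear W (fcoef l) \<or> product_split W (fcoef l) \<or> sum_split W (fcoef l)"
        using Node.IH(1) ro by blast
      have "?c S = (a * (if g = Times then fcoef r {} else 1)) * fcoef l S"
        if S: "S \<subseteq> W" "S \<noteq> {}" for S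
      proof -
        have *: "S \<inter> ?L = S" "S - ?L = {}" "\<not> S \<subseteq> ?R" using WL S ro by auto
        show ?thesis
          using r0[OF S(1) *(3)] plus[OF _ S] times[OF _ S, unfolded *(1,2)]
          by (cases g) (simp_all del: computes.simps)
      qed
      then show ?thesis by (rule read_once_split_scale[OF IH])
    next
      case 2
      then obtain i where i: "W \<inter> ?L = {i}" by (auto simp: card_1_singleton_iff)
      show ?thesis
      proof (cases g)
        case Plus
        \<comment> \<open>A sum gate creates no monomial mixing both sides, so \<open>x_i\<close>
          occurs only linearly.\<close>
        have "?c S = 0" if S: "S \<subseteq> W" "i \<in> S" "2 \<le> card S" for S
        proof -
          have "\<not> S \<subseteq> {i}" using S(3) card_mono[of "{i}" S] by auto
          then have "\<not> S \<subseteq> ?L" "\<not> S \<subseteq> ?R" using i S compl by auto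
          with plus[OF Plus S(1)] l0[OF S(1)] r0[OF S(1)] S(2) show ?thesis by auto
        qed
        with i show ?thesis using line_linear_free[OF Node.prems assms(2), of i] by blast
      next
        case Times
        have "?c S = a * fcoef l (S \<inter> {i}) * fcoef r (S - {i})" if "S \<subseteq> W" "S \<noteq> {}" for S
        proof -
          have "S \<inter> ?L = S \<inter> {i}" "S - ?L = S - {i}" using i that by auto
          with times[OF Times that] show ?thesis by simp
        qed
        with i show ?thesis
          using line_linear_product[OF Node.prems assms(2), of i "\<lambda>S. a * fcoef l S" "fcoef r"]
          by blast
      qed
    next
      case 4
      then obtain i where i: "W - ?L = {i}" by (auto simp: card_1_singleton_iff)
      show ?thesis
      proof (cases g)
        case Plus
        have "?c S = 0" if S: "S \<subseteq> W" "i \<in> S" "2 \<le> card S" for S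
        proof -
          have "\<not> S \<subseteq> {i}" using S(3) card_mono[of "{i}" S] by auto
          then have "\<not> S \<subseteq> ?L" "\<not> S \<subseteq> ?R" using i S compl by auto
          with plus[OF Plus S(1)] l0[OF S(1)] r0[OF S(1)] S(2) show ?thesis by auto
        qed
        with i show ?thesis using line_linear_free[OF Node.prems assms(2), of i] by blast
      next
        case Times
        have "?c S = a * fcoef r (S \<inter> {i}) * fcoef l (S - {i})" if "S \<subseteq> W" "S \<noteq> {}" for S
        proof -
          have "S - ?L = S \<inter> {i}" "S \<inter> ?L = S - {i}" using i that by auto
          with times[OF Times that] show ?thesis by (simp add: mult_ac)
        qed
        with i show ?thesis
          using line_linear_product[OF Node.prems assms(2), of i "\<lambda>S. a * fcoef r S" "fcoef l"]
          by blast
      qed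
    next
      case 3
      then have c2: "card (W - ?L) = 2" using card by simp
      let ?A = "W \<inter> ?L"
      show ?thesis
      proof (cases g)
        case Plus
        \<comment> \<open>A set of size at least 2 inside a half of size 2 is that half; every other
          set is mixed.\<close>
        have "?c S = 0" if S: "S \<subseteq> W" "2 \<le> card S" "S \<noteq> ?A" "S \<noteq> W - ?A" for S
        proof -
          have "\<not> S \<subseteq> ?A" using card_seteq[of ?A S] S 3 finW by auto
          moreover have "\<not> S \<subseteq> W - ?L"
            using card_seteq[of "W - ?L" S] S c2 finW by (auto simp: Diff_Int)
          ultimately have "\<not> S \<subseteq> ?L" "\<not> S \<subseteq> ?R" using compl S(1) by auto
          with plus[OF Plus S(1)] l0[OF S(1)] r0[OF S(1)] show ?thesis by auto
        qed
        with 3 have "sum_split W ?c"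
          unfolding sum_split_def by (intro exI[of _ ?A]) (auto simp del: computes.simps)
        then show ?thesis by blast
      next
        case Times
        have eq: "?c S = a * fcoef l (S \<inter> ?A) * fcoef r (S - ?A)"
          if "S \<subseteq> W" "S \<noteq> {}" for S
        proof -
          have "S \<inter> ?A = S \<inter> ?L" "S - ?A = S - ?L" using that by auto
          with times[OF Times that] show ?thesis by simp
        qed
        have "product_split W ?c"
          by (rule product_splitI[of ?A _ _ "\<lambda>S. a * fcoef l S" "fcoef r"])
            (simp_all add: 3 eq del: computes.simps)
        then show ?thesis by blast
      qed
    qed
  qed
qed

section \<open>Sums of two read-once polynomials\<close>

text \<open>Indices name the variables of a monomial, with 0 for the constant; primes mark the
  second product. The nonzero vector \<open>(g12, g12')\<close> annihilates \<open>(h3, h3')\<close>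
  and \<open>(h4, h4')\<close>, so these are dependent. By Cauchy-Binet the minor with rows
  \<open>b, c\<close> and \<open>c, b\<close> vanishes.\<close>

lemma two_products_same_split:
  fixes a b c :: "'a::idom"
  assumes "g12 * h0 + g12' * h0' = a" "a \<noteq> 0"
    and "g12 * h3 + g12' * h3' = 0" "g12 * h4 + g12' * h4' = 0"
    and "g1 * h3 + g1' * h3' = b" "g2 * h4 + g2' * h4' = b"
    and "g1 * h4 + g1' * h4' = c" "g2 * h3 + g2' * h3' = c"
  shows "b\<^sup>2 = c\<^sup>2"
proof -
  have "g12 * (h3 * h4' - h4 * h3') = 0" "g12' * (h3 * h4' - h4 * h3') = 0"
    using assms(3,4) by algebra+
  moreover have "g12 \<noteq> 0 \<or> g12' \<noteq> 0"
    using assms(1,2) by auto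
  ultimately have "h3 * h4' - h4 * h3' = 0"
    by auto
  moreover have "b\<^sup>2 - c\<^sup>2 = (g1 * h3 + g1' * h3') * (g2 * h4 + g2' * h4')
      - (g1 * h4 + g1' * h4') * (g2 * h3 + g2' * h3')"
    by (simp only: assms(5-8) power2_eq_square)
  moreover have "\<dots> = (g1 * g2' - g2 * g1') * (h3 * h4' - h4 * h3')"
    by (simp add: algebra_simps)
  ultimately show ?thesis by simp
qed

text \<open>The first product splits the variables as 12 against 34, the primed one as 13 against
  24. Vanishing cubic and quartic terms make all factors affine linear, and the remaining quadratic
  terms determine a square.\<close>

lemma two_products_cross_split:
  fixes a b c :: "'a::idom"
  assumes nz: "a \<noteq> 0" "b \<noteq> 0" "c \<noteq> 0"
    and x12: "g12 * h0 + g1' * h2' = a" and x34: "g0 * h34 + g3' * h4' = a"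
    and x13: "g1 * h3 + g13' * h0' = b" and x24: "g2 * h4 + g0' * h24' = b"
    and x14: "g1 * h4 + g1' * h4' = c" and x23: "g2 * h3 + g3' * h2' = c"
    and x123: "g12 * h3 + g13' * h2' = 0" and x124: "g12 * h4 + g1' * h24' = 0"
    and x134: "g1 * h34 + g13' * h4' = 0" and x234: "g2 * h34 + g3' * h24' = 0"
    and x1234: "g12 * h34 + g13' * h24' = 0"
  shows "\<exists>X. X\<^sup>2 = (a\<^sup>2 - b\<^sup>2 - c\<^sup>2)\<^sup>2 - (2 * b * c)\<^sup>2"
proof -
  \<comment> \<open>Multiplying the quartic contribution by \<open>c\<close> lets the cubic
    relations rewrite it as two cancelling terms.\<close>
  have "c * (g12 * h34) = (g1 * h34) * (g12 * h4) + (g1' * h4') * (g12 * h34)"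
    by (simp add: algebra_simps flip: x14)
  also have "g12 * h34 = - (g13' * h24')"
    using x1234 by (simp add: eq_neg_iff_add_eq_0)
  also have "g1 * h34 = - (g13' * h4')"
    using x134 by (simp add: eq_neg_iff_add_eq_0)
  also have "g12 * h4 = - (g1' * h24')"
    using x124 by (simp add: eq_neg_iff_add_eq_0)
  also have "- (g13' * h4') * - (g1' * h24') + (g1' * h4') * - (g13' * h24') = 0"
    by (simp add: algebra_simps)
  finally have "g13' * h24' = 0"
    using nz(3) by simp
  with x1234 have "g12 = 0 \<or> h34 = 0" "g13' = 0 \<or> h24' = 0"
    by auto
  \<comment> \<open>One vanishing top coefficient forces the others: the quadratic terms then need
    nonzero linear coefficients, and the cubic relations do the rest.\<close>
  with nz assms(4-13) have z: "g12 = 0" "h34 = 0" "g13' = 0" "h24' = 0"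
    by auto
  \<comment> \<open>The contributions of the first product to the terms 14 and 23; the second
    product contributes \<open>c - u\<close> and \<open>c - v\<close>.\<close>
  define u v where uv: "u = g1 * h4" "v = g2 * h3"
  have "u * v = (g1 * h3 + g13' * h0') * (g2 * h4 + g0' * h24')"
    by (simp add: z uv mult_ac)
  then have "u * v = b\<^sup>2"
    by (simp only: x13 x24 power2_eq_square)
  moreover have "c - u = g1' * h4'" "c - v = g3' * h2'"
    using x14 x23 by (simp_all add: uv diff_eq_eq add.commute)
  then have "(c - u) * (c - v) = (g12 * h0 + g1' * h2') * (g0 * h34 + g3' * h4')"
    by (simp add: z mult_ac)
  then have "(c - u) * (c - v) = a\<^sup>2"
    by (simp only: x12 x34 power2_eq_square)
  \<comment> \<open>The two relations give \<open>u * v = b\<^sup>2\<close> and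
    \<open>c * (u + v) = b\<^sup>2 + c\<^sup>2 - a\<^sup>2\<close>, so the right-hand side is
    \<open>c\<^sup>2 * ((u + v)\<^sup>2 - 4 * u * v)\<close>.\<close>
  ultimately have "(c * (u - v))\<^sup>2 = (a\<^sup>2 - b\<^sup>2 - c\<^sup>2)\<^sup>2 - (2 * b * c)\<^sup>2"
    by algebra
  then show ?thesis ..
qed

text \<open>C1, C2 and C3 appear as \<open>nonzero\<close>, \<open>squares\<close> and
  \<open>nonsquare\<close>, stated for every labelling of \<open>W\<close>, so that later arguments
  may choose labels to suit a given partition.\<close>

locale generic_pairing_form =
  fixes F :: "nat set \<Rightarrow> 'a::field" and W :: "nat set"
  assumes card_W: "card W = 4"
    and nonzero: "i \<in> W \<Longrightarrow> j \<in> W \<Longrightarrow> i \<noteq> j \<Longrightarrow> F {i, j} \<noteq> 0"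
    and opposite: "distinct [i, j, k, l] \<Longrightarrow> W = {i, j, k, l} \<Longrightarrow> F {k, l} = F {i, j}"
    and squares: "distinct [i, j, k] \<Longrightarrow> {i, j, k} \<subseteq> W \<Longrightarrow> (F {i, j})\<^sup>2 \<noteq> (F {i, k})\<^sup>2"
    and nonsquare: "distinct [i, j, k, l] \<Longrightarrow> W = {i, j, k, l} \<Longrightarrow>
      X\<^sup>2 \<noteq> ((F {i, j})\<^sup>2 - (F {i, k})\<^sup>2 - (F {i, l})\<^sup>2)\<^sup>2 - (2 * F {i, k} * F {i, l})\<^sup>2"
    and higher: "S \<subseteq> W \<Longrightarrow> 3 \<le> card S \<Longrightarrow> F S = 0"
begin

definition splits_into :: "(nat set \<Rightarrow> 'a) \<Rightarrow> (nat set \<Rightarrow> 'a) \<Rightarrow> bool" where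
  "splits_into c d \<longleftrightarrow> (\<forall>S\<subseteq>W. 2 \<le> card S \<longrightarrow> c S + d S = F S)"

lemma splits_intoD: "splits_into c d \<Longrightarrow> S \<subseteq> W \<Longrightarrow> 2 \<le> card S \<Longrightarrow> c S + d S = F S"
  by (simp add: splits_into_def)

lemma splits_into_pair:
  "splits_into c d \<Longrightarrow> i \<in> W \<Longrightarrow> j \<in> W \<Longrightarrow> i \<noteq> j \<Longrightarrow> c {i, j} + d {i, j} = F {i, j}"
  by (simp add: splits_intoD)

lemma splits_into_higher: "splits_into c d \<Longrightarrow> S \<subseteq> W \<Longrightarrow> 3 \<le> card S \<Longrightarrow> c S + d S = 0"
  using splits_intoD[of c d S] higher[of S] by simp

lemma splits_into_commute: "splits_into c d \<Longrightarrow> splits_into d c"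
  by (simp add: splits_into_def add.commute)

lemma obtain_pair:
  assumes "A \<subseteq> W" "card A = 2"
  obtains i j k l where "A = {i, j}" "W = {i, j, k, l}" "distinct [i, j, k, l]"
proof -
  have "finite W" using card_W card.infinite by fastforce
  then have "card (W - A) = 2"
    using assms card_W finite_subset by (subst card_Diff_subset) auto
  with assms(2) obtain i j k l where *: "A = {i, j}" "i \<noteq> j" "W - A = {k, l}" "k \<noteq> l"
    by (metis card_2_iff)
  show thesis
  proof (rule that)
    show "W = {i, j, k, l}" using * assms(1) by auto
    show "distinct [i, j, k, l]" using * by auto
  qed fact
qed

text \<open>After setting \<open>x_i\<close> to \<open>t\<close>, the other summand alone must
  supply the quadratic terms of the form in three variables. All are nonzero and there is no cubic
  term, against \<open>fcoef_triangle\<close>.\<close>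

lemma not_line_linear:
  assumes "read_once_formula \<phi>" "splits_into c (fcoef \<phi>)"
  shows "\<not> line_linear W c"
proof
  assume "line_linear W c"
  then obtain i t where i: "i \<in> W"
    and t: "\<And>S. S \<subseteq> W - {i} \<Longrightarrow> 2 \<le> card S \<Longrightarrow> c S + t * c (insert i S) = 0"
    unfolding line_linear_def by blast
  have "card (W - {i}) = 3" using card_W i by simp
  then obtain j k l where jkl: "W - {i} = {j, k, l}" "j \<noteq> k" "k \<noteq> l" "j \<noteq> l"
    by (metis card_3_iff)
  have ne: "i \<noteq> j" "i \<noteq> k" "i \<noteq> l" using jkl(1) by auto
  have W: "W = {i, j, k, l}" using jkl(1) i by auto
  have q: "fcoef (restrict i t \<phi>) S = F S" if S: "S \<subseteq> {j, k, l}" "2 \<le> card S" for S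
  proof -
    have fin: "finite S" and iS: "i \<notin> S" using S(1) ne finite_subset by auto
    then have card: "card (insert i S) = Suc (card S)" by simp
    have sub: "S \<subseteq> W" "insert i S \<subseteq> W" "S \<subseteq> W - {i}" using S(1) W iS by auto
    have "fcoef (restrict i t \<phi>) S = (F S - c S) + t * (F (insert i S) - c (insert i S))"
    proof -
      have "fcoef \<phi> S = F S - c S"
        using splits_intoD[OF assms(2) sub(1) S(2)] by (simp add: algebra_simps)
      moreover have "fcoef \<phi> (insert i S) = F (insert i S) - c (insert i S)"
        using splits_intoD[OF assms(2) sub(2)] card S(2) by (simp add: algebra_simps)
      ultimately show ?thesis
        by (simp add: fcoef_restrict[OF assms(1) fin iS])
    qed
    moreover have "F (insert i S) = 0" using higher[OF sub(2)] card S(2) by simp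
    ultimately show ?thesis using t[OF sub(3) S(2)] by (simp add: algebra_simps)
  qed
  have "fcoef (restrict i t \<phi>) {j, k, l} \<noteq> 0"
    using fcoef_triangle[of "restrict i t \<phi>" j k l] assms(1) jkl nonzero[of j k] nonzero[of j l]
      nonzero[of k l] W by (simp add: q)
  moreover have "F {j, k, l} = 0" using higher[of "{j, k, l}"] jkl W by auto
  ultimately show False using q[of "{j, k, l}"] jkl by simp
qed

lemma product_split_quad:
  assumes "distinct [i, j, k, l]" "W = {i, j, k, l}"
    and "\<forall>S\<subseteq>W. S \<noteq> {} \<longrightarrow> c S = g (S \<inter> {i, j}) * h (S - {i, j})"
  shows "c {i, j} = g {i, j} * h {}" "c {k, l} = g {} * h {k, l}"
    "c {i, k} = g {i} * h {k}" "c {i, l} = g {i} * h {l}"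
    "c {j, k} = g {j} * h {k}" "c {j, l} = g {j} * h {l}"
    "c {i, j, k} = g {i, j} * h {k}" "c {i, j, l} = g {i, j} * h {l}"
    "c {i, k, l} = g {i} * h {k, l}" "c {j, k, l} = g {j} * h {k, l}"
    "c {i, j, k, l} = g {i, j} * h {k, l}"
  using assms by (simp_all add: Int_insert_left insert_Diff_if)

text \<open>The four prescribed pairs form a 4-cycle. A product carrying them either has a cubic
  term or, if its halves are \<open>{i, j}\<close> and \<open>{k, l}\<close>, has cross coefficients
  of rank one, which makes two squares equal.\<close>

lemma not_product_split_quadrangle:
  assumes dist: "distinct [i, j, k, l]" "W = {i, j, k, l}"
    and cross: "\<And>S. S \<subseteq> W \<Longrightarrow> card S = 2 \<Longrightarrow> S \<noteq> {i, j} \<Longrightarrow> S \<noteq> {k, l} \<Longrightarrow> d S = F S"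
    and cubic: "\<And>S. S \<subseteq> W \<Longrightarrow> card S = 3 \<Longrightarrow> d S = 0"
  shows "\<not> product_split W d"
proof
  assume "product_split W d"
  then obtain A g h where A: "A \<subseteq> W" "card A = 2"
    and gh: "\<forall>S\<subseteq>W. S \<noteq> {} \<longrightarrow> d S = g (S \<inter> A) * h (S - A)"
    unfolding product_split_def by blast
  obtain p q r s where pqrs: "A = {p, q}" "W = {p, q, r, s}" "distinct [p, q, r, s]"
    using obtain_pair[OF A] .
  note gh' = product_split_quad[OF pqrs(3,2) gh[unfolded pqrs(1)]]
  have zero: "{x, y} = {i, j} \<or> {x, y} = {k, l}" if "d {x, y} = 0" "x \<in> W" "y \<in> W" "x \<noteq> y" for x y
    using cross[of "{x, y}"] nonzero[of x y] that by auto
  show False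
  proof (cases "d {p, q} = 0")
    case False
    \<comment> \<open>Here \<open>g {p, q}\<close> is nonzero, so the linear coefficients of
      \<open>h\<close> vanish. Then \<open>{p, r}\<close> and \<open>{p, s}\<close> both lie among
      the disjoint pairs \<open>{i, j}\<close> and \<open>{k, l}\<close>, yet they share only
      \<open>p\<close>.\<close>
    have "d {p, q, r} = 0" "d {p, q, s} = 0"
      using cubic[of "{p, q, r}"] cubic[of "{p, q, s}"] pqrs by auto
    with gh' False have "d {p, r} = 0" "d {p, s} = 0" by auto
    with zero[of p r] zero[of p s] pqrs
    have "{p, r} = {i, j} \<or> {p, r} = {k, l}" "{p, s} = {i, j} \<or> {p, s} = {k, l}" by auto
    with dist(1) pqrs(3) show False by (auto simp: doubleton_eq_iff)
  next
    case True
    with zero[of p q] pqrs have "{p, q} = {i, j} \<or> {p, q} = {k, l}" by auto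
    then have "{x, y} \<noteq> {i, j} \<and> {x, y} \<noteq> {k, l}" if "x \<in> {p, q}" "y \<in> {r, s}" for x y
      using that dist(1) pqrs(3) by (auto simp: doubleton_eq_iff)
    then have "d {x, y} = F {x, y}" if "x \<in> {p, q}" "y \<in> {r, s}" for x y
      using that pqrs by (intro cross) auto
    moreover have "d {p, r} * d {q, s} = d {p, s} * d {q, r}"
      using gh' by simp
    ultimately have "F {p, r} * F {q, s} = F {p, s} * F {q, r}"
      by simp
    moreover have "F {q, s} = F {p, r}" "F {q, r} = F {p, s}"
      using opposite[of p r q s] opposite[of p s q r] pqrs by auto
    ultimately show False
      using squares[of p r s] pqrs by (simp add: power2_eq_square)
  qed
qed

text \<open>The other summand must carry the 4-cycle of pairs outside \<open>A\<close> and its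
  complement, and none of the three shapes permits this.\<close>

lemma not_sum_split:
  assumes "read_once_formula \<phi>" "read_once_formula \<psi>" "splits_into (fcoef \<phi>) (fcoef \<psi>)"
  shows "\<not> sum_split W (fcoef \<phi>)"
proof
  let ?c = "fcoef \<phi>" and ?d = "fcoef \<psi>"
  assume "sum_split W ?c"
  then obtain A where A: "A \<subseteq> W" "card A = 2"
    and c0: "\<And>S. S \<subseteq> W \<Longrightarrow> 2 \<le> card S \<Longrightarrow> S \<noteq> A \<Longrightarrow> S \<noteq> W - A \<Longrightarrow> ?c S = 0"
    unfolding sum_split_def by blast
  obtain i j k l where ijkl: "A = {i, j}" "W = {i, j, k, l}" "distinct [i, j, k, l]"
    using obtain_pair[OF A] .
  have WA: "W - A = {k, l}" using ijkl by auto
  have d: "?d S = F S" if "S \<subseteq> W" "2 \<le> card S" "S \<noteq> {i, j}" "S \<noteq> {k, l}" for S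
    using splits_intoD[OF assms(3) that(1,2)] c0[OF that(1,2)] that(3,4) ijkl(1) WA by simp
  have nz: "?d {i, k} = F {i, k}" "?d {i, l} = F {i, l}"
    using ijkl by (auto intro!: d simp: doubleton_eq_iff)
  have cubic: "?d S = 0" if "S \<subseteq> W" "card S = 3" for S
  proof -
    have "card {i, j} = 2" "card {k, l} = 2" using ijkl(3) by auto
    with that(2) have "S \<noteq> {i, j}" "S \<noteq> {k, l}" by auto
    with d higher that show ?thesis by simp
  qed
  have "\<not> product_split W ?d"
    by (rule not_product_split_quadrangle[OF ijkl(3,2)]) (auto intro: d cubic)
  moreover have "\<not> line_linear W ?d"
    by (rule not_line_linear[OF assms(1) splits_into_commute[OF assms(3)]])
  ultimately have "sum_split W ?d"
    using read_once_split[OF assms(2) card_W] by simp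
  then obtain B where B: "B \<subseteq> W" "card B = 2"
    and d0: "\<And>S. S \<subseteq> W \<Longrightarrow> 2 \<le> card S \<Longrightarrow> S \<noteq> B \<Longrightarrow> S \<noteq> W - B \<Longrightarrow> ?d S = 0"
    unfolding sum_split_def by blast
  \<comment> \<open>Two distinct pairs sharing \<open>i\<close> cannot both belong to a partition
    into pairs.\<close>
  have "{i, k} = B \<or> {i, k} = W - B" "{i, l} = B \<or> {i, l} = W - B"
    using d0[of "{i, k}"] d0[of "{i, l}"] nz ijkl nonzero[of i k] nonzero[of i l] by auto
  then show False using ijkl(3) by auto
qed

text \<open>Equal partitions are excluded by the rank argument, crossing ones by the
  discriminant.\<close>

lemma not_both_product_split:
  assumes "splits_into c d" "product_split W c"
  shows "\<not> product_split W d"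
proof
  assume "product_split W d"
  then obtain B g' h' where B: "B \<subseteq> W" "card B = 2"
    and gh': "\<And>S. S \<subseteq> W \<Longrightarrow> S \<noteq> {} \<Longrightarrow> d S = g' (S \<inter> B) * h' (S - B)"
    unfolding product_split_def by blast
  obtain A g h where A: "A \<subseteq> W" "card A = 2"
    and gh: "\<forall>S\<subseteq>W. S \<noteq> {} \<longrightarrow> c S = g (S \<inter> A) * h (S - A)"
    using assms(2) unfolding product_split_def by blast
  have same: False if gh'': "\<forall>S\<subseteq>W. S \<noteq> {} \<longrightarrow> d S = g' (S \<inter> A) * h' (S - A)" for g' h'
  proof -
    obtain i j k l where ijkl: "A = {i, j}" "W = {i, j, k, l}" "distinct [i, j, k, l]"
      using obtain_pair[OF A] .
    note c = product_split_quad[OF ijkl(3,2) gh[unfolded ijkl(1)]]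
    note d = product_split_quad[OF ijkl(3,2) gh''[unfolded ijkl(1)]]
    have "F {j, l} = F {i, k}" "F {j, k} = F {i, l}"
      using opposite[of i k j l] opposite[of i l j k] ijkl by auto
    then have F: "c {i, j} + d {i, j} = F {i, j}"
        "c {i, k} + d {i, k} = F {i, k}" "c {j, l} + d {j, l} = F {i, k}"
        "c {i, l} + d {i, l} = F {i, l}" "c {j, k} + d {j, k} = F {i, l}"
        "c {i, j, k} + d {i, j, k} = 0" "c {i, j, l} + d {i, j, l} = 0"
      using ijkl(2,3) splits_into_higher[OF assms(1), of "{i, j, k}"]
        splits_into_higher[OF assms(1), of "{i, j, l}"]
      by (simp_all add: splits_into_pair[OF assms(1)])
    have "F {i, j} \<noteq> 0" using nonzero ijkl by auto
    note F' = F[unfolded c d]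
    have "(F {i, k})\<^sup>2 = (F {i, l})\<^sup>2"
      by (rule two_products_same_split[OF F'(1) \<open>F {i, j} \<noteq> 0\<close> F'(6,7,2,3,4,5)])
    then show False using squares[of i k l] ijkl by auto
  qed
  show False
  proof (cases "B = A \<or> B = W - A")
    case True
    then show False
    proof
      assume "B = A"
      then show False using same[of g' h'] gh' by blast
    next
      assume BA: "B = W - A"
      have "d S = h' (S \<inter> A) * g' (S - A)" if "S \<subseteq> W" "S \<noteq> {}" for S
      proof -
        have "S \<inter> B = S - A" "S - B = S \<inter> A" using BA that A(1) by auto
        with gh'[OF that] show ?thesis by (simp add: mult.commute)
      qed
      then show False using same[of h' g'] by blast
    qed
  next
    case False
    \<comment> \<open>Distinct partitions into pairs cross, so \<open>A\<close> and \<open>B\<close>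
      share exactly one point, called \<open>i\<close>.\<close>
    obtain i j k l where ijkl: "A = {i, j}" "W = {i, k, j, l}" "B = {i, k}" "distinct [i, j, k, l]"
    proof -
      obtain p q r s where pqrs: "A = {p, q}" "W = {p, q, r, s}" "distinct [p, q, r, s]"
        using obtain_pair[OF A] .
      obtain x y where xy: "B = {x, y}" "x \<noteq> y" using B(2) by (metis card_2_iff)
      have "W - A = {r, s}" using pqrs by auto
      with False B(1) xy pqrs consider "B = {p, r}" | "B = {p, s}" | "B = {q, r}" | "B = {q, s}"
        by auto
      then show thesis
        using pqrs that[of p q r s] that[of p q s r] that[of q p r s] that[of q p s r]
        by cases (auto simp: insert_commute)
    qed
    have W: "W = {i, j, k, l}" and dist: "distinct [i, k, j, l]" using ijkl by auto
    note c = product_split_quad[OF ijkl(4) W gh[unfolded ijkl(1)]]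
    have "\<forall>S\<subseteq>W. S \<noteq> {} \<longrightarrow> d S = g' (S \<inter> {i, k}) * h' (S - {i, k})"
      using gh' ijkl(3) by blast
    note d = product_split_quad[OF dist ijkl(2) this]
    have kj: "{k, j} = {j, k}" "{i, k, j} = {i, j, k}" "{k, j, l} = {j, k, l}"
        "{i, k, j, l} = {i, j, k, l}" by auto
    have "F {k, l} = F {i, j}" "F {j, l} = F {i, k}" "F {j, k} = F {i, l}"
      using opposite[of i j k l] opposite[of i k j l] opposite[of i l j k] W ijkl(4) by auto
    then have F: "c {i, j} + d {i, j} = F {i, j}" "c {k, l} + d {k, l} = F {i, j}"
        "c {i, k} + d {i, k} = F {i, k}" "c {j, l} + d {j, l} = F {i, k}"
        "c {i, l} + d {i, l} = F {i, l}" "c {j, k} + d {j, k} = F {i, l}"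
      using W ijkl(4) by (simp_all add: splits_into_pair[OF assms(1)])
    have Z: "c {i, j, k} + d {i, j, k} = 0" "c {i, j, l} + d {i, j, l} = 0"
        "c {i, k, l} + d {i, k, l} = 0" "c {j, k, l} + d {j, k, l} = 0"
        "c {i, j, k, l} + d {i, j, k, l} = 0"
      using W ijkl(4) by (simp_all add: splits_into_higher[OF assms(1)])
    have nz: "F {i, j} \<noteq> 0" "F {i, k} \<noteq> 0" "F {i, l} \<noteq> 0" using nonzero W ijkl(4) by auto
    note FZ = F[unfolded c d[unfolded kj]] Z[unfolded c d[unfolded kj]]
    have "\<exists>X. X\<^sup>2 = ((F {i, j})\<^sup>2 - (F {i, k})\<^sup>2 - (F {i, l})\<^sup>2)\<^sup>2 - (2 * F {i, k} * F {i, l})\<^sup>2"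
      by (rule two_products_cross_split[OF nz FZ])
    then show False using nonsquare[OF ijkl(4) W] by blast
  qed
qed

lemma not_sum_of_read_once:
  assumes "read_once_formula \<phi>" "read_once_formula \<psi>"
  shows "\<not> splits_into (fcoef \<phi>) (fcoef \<psi>)"
proof
  assume *: "splits_into (fcoef \<phi>) (fcoef \<psi>)"
  note * = * splits_into_commute[OF *]
  show False
    using read_once_split[OF assms(1) card_W] read_once_split[OF assms(2) card_W]
      not_line_linear[OF assms(1) *(2)] not_line_linear[OF assms(2) *(1)]
      not_sum_split[OF assms *(1)] not_sum_split[OF assms(2,1) *(2)]
      not_both_product_split[OF *(1)] by blast
qed

end

section \<open>Decompositions\<close>

lemma Const_0 [simp]: "Const 0 = 0"
  by (simp add: Const_def)

lemma Const_1 [simp]: "Const 1 = 1"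
  by (simp add: Const_def)

lemma Const_add: "Const (a + b) = Const a + Const b"
  by (simp add: Const_def single_add)

lemma Const_mult: "Const (a * b) = Const a * Const (b :: 'a::comm_ring_1)"
  by (simp add: Const_def mult_single)

lemma read_once_polynomial_iff:
  "read_once_polynomial p \<longleftrightarrow> (\<exists>\<phi>. read_once_formula \<phi> \<and> computes \<phi> = p)"
proof -
  have "\<exists>\<phi>. read_once_formula \<phi> \<and> computes \<phi> = Const c" for c :: 'a
    by (intro exI[of _ "Leaf 0 0 c"]) (simp add: read_once_formula_def)
  then show ?thesis by (auto simp: read_once_polynomial_def)
qed

lemma read_once_sum:
  "distinct [i, j, k, l] \<Longrightarrow> read_once_polynomial (Const a * (Var i * Var j + Var k * Var l))"
  unfolding read_once_polynomial_iff
  by (rule exI[of _ "Node Plus a 0 (Node Times 1 0 (Leaf i 1 0) (Leaf j 1 0))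
      (Node Times 1 0 (Leaf k 1 0) (Leaf l 1 0))"]) (simp add: read_once_formula_def)

lemma read_once_product:
  "distinct [i, j, k, l] \<Longrightarrow> read_once_polynomial
    ((Const a * Var i + Const b * Var j) * (Const c * Var k + Const d * Var l))"
  unfolding read_once_polynomial_iff
  by (rule exI[of _ "Node Times 1 0 (Node Plus 1 0 (Leaf i a 0) (Leaf j b 0))
      (Node Plus 1 0 (Leaf k c 0) (Leaf l d 0))"]) (simp add: read_once_formula_def)

text \<open>The indices are parameters so that permuting variables becomes permuting
  coefficients.\<close>

definition pairing_form :: "'a::comm_ring_1 \<Rightarrow> 'a \<Rightarrow> 'a \<Rightarrow> nat \<Rightarrow> nat \<Rightarrow> nat \<Rightarrow> nat \<Rightarrow> 'a mpoly" where
  "pairing_form \<alpha> \<beta> \<gamma> i j k l = Const \<alpha> * (Var i * Var j + Var k * Var l)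
     + Const \<beta> * (Var i * Var k + Var j * Var l) + Const \<gamma> * (Var i * Var l + Var j * Var k)"

definition sum_of_two_read_once :: "'a::comm_ring_1 mpoly \<Rightarrow> bool" where
  "sum_of_two_read_once f \<longleftrightarrow>
    (\<exists>p q. read_once_polynomial p \<and> read_once_polynomial q \<and> f = p + q)"

lemma sum_of_two_read_onceI:
  "read_once_polynomial p \<Longrightarrow> read_once_polynomial q \<Longrightarrow> f = p + q \<Longrightarrow> sum_of_two_read_once f"
  unfolding sum_of_two_read_once_def by blast

lemma pairing_form_swap:
  "pairing_form \<alpha> \<beta> \<gamma> i j k l = pairing_form \<beta> \<alpha> \<gamma> i k j l"
  "pairing_form \<alpha> \<beta> \<gamma> i j k l = pairing_form \<gamma> \<beta> \<alpha> i l k j"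
  by (simp_all add: pairing_form_def algebra_simps)

text \<open>Each of the two remaining blocks is read-once by itself.\<close>

lemma pairing_form_zero:
  "distinct [i, j, k, l] \<Longrightarrow> sum_of_two_read_once (pairing_form 0 \<beta> \<gamma> i j k l)"
  by (rule sum_of_two_read_onceI[OF read_once_sum[of i k j l \<beta>] read_once_sum[of i l j k \<gamma>]])
    (simp_all add: pairing_form_def)

text \<open>With \<open>\<beta> = e * \<alpha>\<close> and \<open>e\<close> a sign, the first two
  blocks factor as \<open>\<alpha> * (x_i + e * x_l) * (x_j + e * x_k)\<close>.\<close>

lemma pairing_form_equal_squares:
  fixes \<alpha> \<beta> \<gamma> :: "'a::idom"
  assumes "distinct [i, j, k, l]" "\<alpha>\<^sup>2 = \<beta>\<^sup>2"
  shows "sum_of_two_read_once (pairing_form \<alpha> \<beta> \<gamma> i j k l)"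
proof -
  from assms(2) obtain e where e: "\<beta> = e * \<alpha>" "e * e = 1"
    by (metis mult_1 mult_minus_left mult_minus_right minus_minus power2_eq_iff)
  have e': "Const e * Const e = 1"
    by (simp add: e(2) flip: Const_mult)
  show ?thesis
  proof (rule sum_of_two_read_onceI)
    show "read_once_polynomial
        ((Const \<alpha> * Var i + Const (e * \<alpha>) * Var l) * (Const 1 * Var j + Const e * Var k))"
      using assms(1) by (intro read_once_product) auto
    show "read_once_polynomial (Const \<gamma> * (Var i * Var l + Var j * Var k))"
      using assms(1) by (intro read_once_sum) auto
    have "Const e * Const \<alpha> * Var l * (Const e * Var k) = (Const e * Const e) * (Const \<alpha> * Var k * Var l)"
      by (simp only: mult_ac)
    then show "pairing_form \<alpha> \<beta> \<gamma> i j k l =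
        (Const \<alpha> * Var i + Const (e * \<alpha>) * Var l) * (Const 1 * Var j + Const e * Var k)
          + Const \<gamma> * (Var i * Var l + Var j * Var k)"
      unfolding pairing_form_def e(1) Const_mult e' by (simp add: algebra_simps)
  qed
qed

text \<open>The form is a sum of two products split along \<open>{i, j}\<close> and \<open>{i, k}\<close>; these give the terms
  \<open>i l\<close> and \<open>j k\<close> coefficients \<open>u, \<beta>\<^sup>2 / u\<close> and \<open>\<gamma> - u, \<alpha>\<^sup>2 / (\<gamma> - u)\<close>, and equating
  \<open>\<beta>\<^sup>2 / u + \<alpha>\<^sup>2 / (\<gamma> - u) = \<gamma>\<close> is a quadratic equation for \<open>u\<close>.\<close>

lemma pairing_form_square_discriminant:
  fixes \<alpha> \<beta> \<gamma> X :: "'a::field"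
  assumes "(2::'a) \<noteq> 0" "\<alpha> \<noteq> 0" "\<beta> \<noteq> 0" "\<gamma> \<noteq> 0" "distinct [i, j, k, l]"
    and X: "X\<^sup>2 = (\<alpha>\<^sup>2 - \<beta>\<^sup>2 - \<gamma>\<^sup>2)\<^sup>2 - (2 * \<beta> * \<gamma>)\<^sup>2"
  shows "sum_of_two_read_once (pairing_form \<alpha> \<beta> \<gamma> i j k l)"
proof -
  \<comment> \<open>The quadratic formula with \<open>X\<close> as root of the discriminant;
    dividing by \<open>2 * \<gamma>\<close> uses that 2 is nonzero.\<close>
  define u where "u = (X - (\<alpha>\<^sup>2 - \<beta>\<^sup>2 - \<gamma>\<^sup>2)) / (2 * \<gamma>)"
  define w where "w = \<gamma> - u"
  have "X = 2 * \<gamma> * u + (\<alpha>\<^sup>2 - \<beta>\<^sup>2 - \<gamma>\<^sup>2)"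
    using assms by (simp add: u_def)
  then have "4 * \<gamma> * (\<gamma> * u\<^sup>2 + (\<alpha>\<^sup>2 - \<beta>\<^sup>2 - \<gamma>\<^sup>2) * u + \<beta>\<^sup>2 * \<gamma>) = 0"
    using X by algebra
  moreover have "(4::'a) \<noteq> 0"
    using assms(1) by (metis mult_2 mult_eq_0_iff numeral_Bit0)
  ultimately have quad: "\<gamma> * u\<^sup>2 + (\<alpha>\<^sup>2 - \<beta>\<^sup>2 - \<gamma>\<^sup>2) * u + \<beta>\<^sup>2 * \<gamma> = 0"
    using assms(4) by simp
  \<comment> \<open>At 0 and at \<open>\<gamma>\<close> the quadratic takes the nonzero values
    \<open>\<beta>\<^sup>2 * \<gamma>\<close> and
    \<open>\<alpha>\<^sup>2 * \<gamma>\<close>.\<close>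
  then have u: "u \<noteq> 0" and "u \<noteq> \<gamma>"
    using assms by (auto simp: power2_eq_square algebra_simps)
  then have w: "w \<noteq> 0" by (simp add: w_def)
  have "\<beta>\<^sup>2 * w + \<alpha>\<^sup>2 * u = \<gamma> * (u * w)"
    using quad unfolding w_def by algebra
  then have v: "\<beta> / u * \<beta> + \<alpha> / w * \<alpha> = \<gamma>"
    using u w by (simp add: field_simps power2_eq_square)
  have C: "Const (\<beta> / u) * Const u = Const \<beta>" "Const (\<alpha> / w) * Const w = Const \<alpha>"
      "Const u + Const w = Const \<gamma>" "Const (\<beta> / u) * Const \<beta> + Const (\<alpha> / w) * Const \<alpha> = Const \<gamma>"
    using u w v by (simp_all add: w_def flip: Const_mult Const_add)
  show ?thesis
  proof (rule sum_of_two_read_onceI)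
    show "read_once_polynomial
        ((Const 1 * Var i + Const (\<beta> / u) * Var j) * (Const \<beta> * Var k + Const u * Var l))"
      using assms(5) by (intro read_once_product) auto
    show "read_once_polynomial
        ((Const 1 * Var i + Const (\<alpha> / w) * Var k) * (Const \<alpha> * Var j + Const w * Var l))"
      using assms(5) by (intro read_once_product) auto
    have "(Const 1 * Var i + Const (\<beta> / u) * Var j) * (Const \<beta> * Var k + Const u * Var l)
        + (Const 1 * Var i + Const (\<alpha> / w) * Var k) * (Const \<alpha> * Var j + Const w * Var l)
      = Const \<alpha> * (Var i * Var j) + (Const (\<alpha> / w) * Const w) * (Var k * Var l)
        + (Const \<beta> * (Var i * Var k) + (Const (\<beta> / u) * Const u) * (Var j * Var l))
        + ((Const u + Const w) * (Var i * Var l)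
          + (Const (\<beta> / u) * Const \<beta> + Const (\<alpha> / w) * Const \<alpha>) * (Var j * Var k))"
      by (simp add: algebra_simps)
    then show "pairing_form \<alpha> \<beta> \<gamma> i j k l =
        (Const 1 * Var i + Const (\<beta> / u) * Var j) * (Const \<beta> * Var k + Const u * Var l)
        + (Const 1 * Var i + Const (\<alpha> / w) * Var k) * (Const \<alpha> * Var j + Const w * Var l)"
      by (simp only: C pairing_form_def distrib_left)
  qed
qed

section \<open>Coefficients of the form and the equivalence\<close>

lemma coef_Var_mult_Var:
  fixes S :: "nat set"
  assumes "i \<noteq> j" "finite S"
  shows "coef (Var i * Var j :: 'a::comm_ring_1 mpoly) S = (if S = {i, j} then 1 else 0)"
  using assms monomial_of_inject[of "{i, j}" S]
  by (auto simp: coef_def Var_def mult_single lookup_single when_def monomial_of_def)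

lemma coef_pairing_form:
  assumes "distinct [i, j, k, l]" "finite S"
  shows "coef (pairing_form \<alpha> \<beta> \<gamma> i j k l) S =
    \<alpha> * ((if S = {i, j} then 1 else 0) + (if S = {k, l} then 1 else 0))
    + \<beta> * ((if S = {i, k} then 1 else 0) + (if S = {j, l} then 1 else 0))
    + \<gamma> * ((if S = {i, l} then 1 else 0) + (if S = {j, k} then 1 else 0))"
  using assms by (simp add: pairing_form_def coef_add coef_Const_mult coef_Var_mult_Var)

theorem theorem8:
  fixes \<alpha> \<beta> \<gamma> :: "'a::field"
  assumes char_not_2: "(2::'a) \<noteq> 0"
  defines "f \<equiv> Const \<alpha> * (Var 1 * Var 2 + Var 3 * Var 4)
             + Const \<beta> * (Var 1 * Var 3 + Var 2 * Var 4)
             + Const \<gamma> * (Var 1 * Var 4 + Var 2 * Var 3)"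
    and "d1 \<equiv> (\<alpha>^2 - \<beta>^2 - \<gamma>^2)^2 - (2 * \<beta> * \<gamma>)^2"
    and "d2 \<equiv> (- (\<alpha>^2) + \<beta>^2 - \<gamma>^2)^2 - (2 * \<alpha> * \<gamma>)^2"
    and "d3 \<equiv> (- (\<alpha>^2) - \<beta>^2 + \<gamma>^2)^2 - (2 * \<alpha> * \<beta>)^2"
  shows "\<not> (\<exists>p q. read_once_polynomial p \<and> read_once_polynomial q \<and> f = p + q)
    \<longleftrightarrow> \<alpha> * \<beta> * \<gamma> \<noteq> 0
      \<and> (\<alpha>^2 - \<beta>^2) * (\<beta>^2 - \<gamma>^2) * (\<gamma>^2 - \<alpha>^2) \<noteq> 0
      \<and> (\<forall>d \<in> {d1, d2, d3}. \<not> (\<exists>X. X^2 - d = 0))"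
proof -
  \<comment> \<open>All three expand to the sum of the fourth powers minus twice the sum of the
    products of two distinct squares.\<close>
  have d: "d2 = d1" "d3 = d1"
    unfolding d1_def d2_def d3_def by algebra+
  have f: "f = pairing_form \<alpha> \<beta> \<gamma> 1 2 3 4"
    by (simp add: f_def pairing_form_def)
  have "\<not> sum_of_two_read_once f \<longleftrightarrow>
    \<alpha> * \<beta> * \<gamma> \<noteq> 0 \<and> (\<alpha>^2 - \<beta>^2) * (\<beta>^2 - \<gamma>^2) * (\<gamma>^2 - \<alpha>^2) \<noteq> 0 \<and> (\<forall>X. X^2 \<noteq> d1)"
    (is "_ \<longleftrightarrow> ?C")
  proof
    have dist: "distinct [1, 2, 3, 4::nat]" "distinct [1, 3, 2, 4::nat]" "distinct [1, 4, 3, 2::nat]"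
      by auto
    have perm: "f = pairing_form \<beta> \<alpha> \<gamma> 1 3 2 4" "f = pairing_form \<gamma> \<beta> \<alpha> 1 4 3 2"
      using f pairing_form_swap by metis+
    assume not: "\<not> sum_of_two_read_once f"
    then have "\<alpha> \<noteq> 0" "\<beta> \<noteq> 0" "\<gamma> \<noteq> 0"
      using pairing_form_zero[OF dist(1)] pairing_form_zero[OF dist(2)]
        pairing_form_zero[OF dist(3)] f perm by metis+
    moreover have "\<alpha>\<^sup>2 \<noteq> \<beta>\<^sup>2" "\<gamma>\<^sup>2 \<noteq> \<beta>\<^sup>2"
      using not pairing_form_equal_squares[OF dist(1)] pairing_form_equal_squares[OF dist(3)] f perm
      by metis+
    \<comment> \<open>Exchanging the last two variables swaps \<beta> and \<gamma>, which puts
      \<alpha> and \<gamma> in the leading positions.\<close>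
    moreover have "f = pairing_form \<alpha> \<gamma> \<beta> 1 2 4 3"
      by (simp add: f_def pairing_form_def algebra_simps)
    then have "\<alpha>\<^sup>2 \<noteq> \<gamma>\<^sup>2"
      using not pairing_form_equal_squares[of 1 2 4 3 \<alpha> \<gamma> \<beta>] by auto
    moreover have "X\<^sup>2 \<noteq> d1" for X
      using not pairing_form_square_discriminant[OF char_not_2 calculation(1-3) dist(1), of X] f
      unfolding d1_def by metis
    ultimately show ?C by auto
  next
    assume C: ?C
    have c: "S \<subseteq> {1, 2, 3, 4} \<Longrightarrow> coef f S =
        \<alpha> * ((if S = {1, 2} then 1 else 0) + (if S = {3, 4} then 1 else 0))
        + \<beta> * ((if S = {1, 3} then 1 else 0) + (if S = {2, 4} then 1 else 0))
        + \<gamma> * ((if S = {1, 4} then 1 else 0) + (if S = {2, 3} then 1 else 0))" for S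
      unfolding f by (subst coef_pairing_form) (auto intro: finite_subset)
    \<comment> \<open>Pairs are listed in both orders because the enumeration of labellings below
      produces either.\<close>
    have val: "coef f {1, 2} = \<alpha>" "coef f {3, 4} = \<alpha>" "coef f {1, 3} = \<beta>" "coef f {2, 4} = \<beta>"
        "coef f {1, 4} = \<gamma>" "coef f {2, 3} = \<gamma>" "coef f {2, 1} = \<alpha>" "coef f {4, 3} = \<alpha>"
        "coef f {3, 1} = \<beta>" "coef f {4, 2} = \<beta>" "coef f {4, 1} = \<gamma>" "coef f {3, 2} = \<gamma>"
      by (simp_all add: c doubleton_eq_iff)
    have nz: "\<alpha> \<noteq> 0" "\<beta> \<noteq> 0" "\<gamma> \<noteq> 0" "\<alpha>\<^sup>2 \<noteq> \<beta>\<^sup>2" "\<beta>\<^sup>2 \<noteq> \<gamma>\<^sup>2" "\<gamma>\<^sup>2 \<noteq> \<alpha>\<^sup>2" using C by auto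
    \<comment> \<open>Symmetry of the discriminant reduces \<open>nonsquare\<close> for every
      labelling to \<open>d1\<close>.\<close>
    have sym: "(a\<^sup>2 - b\<^sup>2 - c\<^sup>2)\<^sup>2 - (2 * b * c)\<^sup>2 = d1"
      if "(a, b, c) \<in> {(\<alpha>, \<beta>, \<gamma>), (\<alpha>, \<gamma>, \<beta>), (\<beta>, \<alpha>, \<gamma>), (\<beta>, \<gamma>, \<alpha>), (\<gamma>, \<alpha>, \<beta>), (\<gamma>, \<beta>, \<alpha>)}" for a b c
      using that unfolding d1_def by (elim insertE emptyE Pair_inject; simp add: power2_eq_square algebra_simps)
    interpret generic_pairing_form "coef f" "{1, 2, 3, 4}"
    proof
      show "card {1, 2, 3, 4::nat} = 4" by simp
      fix i j :: nat assume "i \<in> {1, 2, 3, 4}" "j \<in> {1, 2, 3, 4}" "i \<noteq> j"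
      then show "coef f {i, j} \<noteq> 0"
        by (elim insertE emptyE; hypsubst) (simp_all add: val[simplified] nz)
    next
      fix i j k l :: nat assume *: "distinct [i, j, k, l]" "{1, 2, 3, 4} = {i, j, k, l}"
      then have "i \<in> {1, 2, 3, 4}" "j \<in> {1, 2, 3, 4}" "k \<in> {1, 2, 3, 4}" "l \<in> {1, 2, 3, 4}" by auto
      then show "coef f {k, l} = coef f {i, j}"
        using *(1) by (elim insertE emptyE; hypsubst) (simp_all add: val[simplified])
    next
      fix i j k :: nat assume *: "distinct [i, j, k]" "{i, j, k} \<subseteq> {1, 2, 3, 4}"
      then have "i \<in> {1, 2, 3, 4}" "j \<in> {1, 2, 3, 4}" "k \<in> {1, 2, 3, 4}" by auto
      then show "(coef f {i, j})\<^sup>2 \<noteq> (coef f {i, k})\<^sup>2"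
        using *(1) by (elim insertE emptyE; hypsubst)
          (simp_all add: val[simplified] nz nz[symmetric])
    next
      fix i j k l :: nat and X assume *: "distinct [i, j, k, l]" "{1, 2, 3, 4} = {i, j, k, l}"
      then have "i \<in> {1, 2, 3, 4}" "j \<in> {1, 2, 3, 4}" "k \<in> {1, 2, 3, 4}" "l \<in> {1, 2, 3, 4}" by auto
      then have "(coef f {i, j}, coef f {i, k}, coef f {i, l}) \<in>
          {(\<alpha>, \<beta>, \<gamma>), (\<alpha>, \<gamma>, \<beta>), (\<beta>, \<alpha>, \<gamma>), (\<beta>, \<gamma>, \<alpha>), (\<gamma>, \<alpha>, \<beta>), (\<gamma>, \<beta>, \<alpha>)}"
        using *(1) by (elim insertE emptyE; hypsubst) (simp_all add: val[simplified])
      from sym[OF this] show "X\<^sup>2 \<noteq> ((coef f {i, j})\<^sup>2 - (coef f {i, k})\<^sup>2 - (coef f {i, l})\<^sup>2)\<^sup>2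
          - (2 * coef f {i, k} * coef f {i, l})\<^sup>2"
        using C by simp
    next
      fix S :: "nat set" assume S: "S \<subseteq> {1, 2, 3, 4}" "3 \<le> card S"
      have "S \<noteq> {a, b}" for a b
        using S(2) by (auto simp: card_insert_if split: if_splits)
      then show "coef f S = 0" by (simp add: c[OF S(1)])
    qed
    show "\<not> sum_of_two_read_once f"
    proof
      assume "sum_of_two_read_once f"
      then obtain \<phi> \<psi> where *: "read_once_formula \<phi>" "read_once_formula \<psi>"
          "f = computes \<phi> + computes \<psi>"
        unfolding sum_of_two_read_once_def read_once_polynomial_iff by blast
      have "splits_into (fcoef \<phi>) (fcoef \<psi>)"
        unfolding splits_into_def by (simp add: *(3) coef_add)
      with not_sum_of_read_once[OF *(1,2)] show False ..
    qed
  qed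
  then show ?thesis
    by (simp add: d sum_of_two_read_once_def)
qed

end
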